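(* The KKT set $\mathcal{K}$ satisfies $$\mathcal{K}\;=\;\bigcup_{J\in\mathcal{P}}\mathcal{K}_J .$$
   Context: Let $n,p,m$ be positive integers, $[m]=\{1,\dots,m\}$, and let $\mathcal{I}_1$ be a finite (possibly empty) index set. Let $F,f,h_i$ ($i\in\mathcal{I}_1$) be real polynomials in $(x,y)\in\mathbb{R}^n\times\mathbb{R}^p$, let $a_1,\dots,a_m\in\mathbb{R}^p$ be constant vectors and $b_1,\dots,b_m$ real polynomials in $x\in\mathbb{R}^n$. Let $A\in\mathbb{R}^{m\times p}$ be the matrix with rows $a_1^T,\dots,a_m^T$, $b(x)=(b_1(x),\dots,b_m(x))^T$, and $t=\operatorname{rank}A$. The bilevel polynomial optimization problem is to minimize $F(x,y)$ subject to $h_i(x,y)\ge 0$ ($i\in\mathcal{I}_1$) and $y\in S(x)$, where $S(x)$ is the set of global minimizers of $f(x,\cdot)$ over $Z(x)=\{y\in\mathbb{R}^p : Ay-b(x)\ge 0\}$. Put $$\mathcal{U}=\{(x,y) : h_i(x,y)\ge 0\ (i\in\mathcal{I}_1),\ a_j^Ty-b_j(x)\ge 0\ (j\in[m])\}.$$ Standing assumption: $S(x)\neq\emptyset$ for every $x$ such that $(x,y)\in\mathcal{U}$ for some $y$. The KKT set $\mathcal{K}$ is the set of all $(x,y)\in\mathcal{U}$ for which there exists $\lambda\in\mathbb{R}^m$ with $\nabla_yf(x,y)-A^T\lambda=0$ and, for all $j\in[m]$, $a_j^Ty-b_j(x)\ge0$, $\lambda_j\ge 0$, $\lambda_j\,(a_j^Ty-b_j(x))=0$.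 For $J\subseteq[m]$, $A_J$ denotes the submatrix of $A$ with rows $a_j^T$, $j\in J$. Let $\mathcal{P}=\{J\subseteq[m] : |J|=t,\ A_J\text{ has full rank}\}$. For $J\in\mathcal{P}$, $\mathcal{K}_J$ is the set of all $(x,y)\in\mathcal{U}$ for which there exists $\lambda_J=(\lambda_j)_{j\in J}$ with $\nabla_yf(x,y)-A_J^T\lambda_J=0$ and, for all $j\in J$, $a_j^Ty-b_j(x)\ge0$, $\lambda_j\ge0$, $\lambda_j\,(a_j^Ty-b_j(x))=0$. *)

theory Defs
  imports "HOL-Analysis.Analysis"
begin

text \<open>
  Points (x, y) live in the product type; real polynomials on a Euclidean space are the
  library's \<^const>\<open>real_polynomial_function\<close>. The matrix A is of type
  \<^typ>\<open>real^'p^'m\<close>, its rows being the vectors A $ j.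
\<close>

definition gradient :: "('a::real_inner \<Rightarrow> real) \<Rightarrow> 'a \<Rightarrow> 'a" where
  "gradient g v = (THE D. GDERIV g v :> D)"

definition grad_y :: "('a \<times> 'b::real_inner \<Rightarrow> real) \<Rightarrow> 'a \<Rightarrow> 'b \<Rightarrow> 'b" where
  "grad_y f x y = gradient (\<lambda>v. f (x, v)) y"

lemma gradient_eqI: "GDERIV g v :> D \<Longrightarrow> gradient g v = D"
  unfolding gradient_def gderiv_def
  by (rule the_equality)
     (assumption, metis has_derivative_unique inner_commute vector_eq_rdot)

lemma GDERIV_gradient:
  fixes g :: "'a::euclidean_space \<Rightarrow> real"
  assumes "g differentiable (at v)"
  shows "GDERIV g v :> gradient g v"
proof -
  obtain g' where g': "(g has_derivative g') (at v)"
    using assms by (auto simp: differentiable_def)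
  interpret linear g' using g' has_derivative_linear by blast
  define D where "D = (\<Sum>i\<in>Basis. g' i *\<^sub>R i)"
  have "g' h = h \<bullet> D" for h
  proof -
    have "g' h = g' (\<Sum>i\<in>Basis. (h \<bullet> i) *\<^sub>R i)" by (simp add: euclidean_representation)
    also have "\<dots> = h \<bullet> D" by (simp add: sum scale D_def inner_sum_right mult.commute)
    finally show ?thesis .
  qed
  hence "g' = (\<lambda>h. h \<bullet> D)" by (rule ext)
  hence "GDERIV g v :> D" using g' by (simp add: gderiv_def)
  thus ?thesis by (simp add: gradient_eqI)
qed

lemma GDERIV_grad_y:
  fixes f :: "'a::euclidean_space \<times> 'b::euclidean_space \<Rightarrow> real"
  assumes "real_polynomial_function f"
  shows "GDERIV (\<lambda>v. f (x, v)) y :> grad_y f x y"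
proof -
  have "f differentiable (at (x, y))"
    using assms differentiable_at_polynomial_function real_polynomial_function_eq by blast
  moreover have "(\<lambda>v. (x, v)) differentiable (at y)"
    by (auto simp: differentiable_def intro!: exI derivative_eq_intros)
  ultimately have "(\<lambda>v. f (x, v)) differentiable (at y)"
    using differentiable_chain_at[of "\<lambda>v. (x, v)" y f] by (simp add: o_def)
  thus ?thesis unfolding grad_y_def by (rule GDERIV_gradient)
qed

definition feasible_y :: "real^'p^'m \<Rightarrow> (real^'n \<Rightarrow> real^'m) \<Rightarrow> real^'n \<Rightarrow> (real^'p) set" where
  "feasible_y A b x = {y. 0 \<le> A *v y - b x}"

definition lower_solutions ::
    "((real^'n) \<times> (real^'p) \<Rightarrow> real) \<Rightarrow> real^'p^'m \<Rightarrow> (real^'n \<Rightarrow> real^'m) \<Rightarrow> real^'n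
      \<Rightarrow> (real^'p) set" where
  "lower_solutions f A b x =
     {y \<in> feasible_y A b x. \<forall>z \<in> feasible_y A b x. f (x, y) \<le> f (x, z)}"

definition constraint_set ::
    "'i set \<Rightarrow> ('i \<Rightarrow> (real^'n) \<times> (real^'p) \<Rightarrow> real) \<Rightarrow> real^'p^'m \<Rightarrow> (real^'n \<Rightarrow> real^'m)
      \<Rightarrow> ((real^'n) \<times> (real^'p)) set" where
  "constraint_set I h A b =
     {(x, y). (\<forall>i\<in>I. h i (x, y) \<ge> 0) \<and> (\<forall>j. A $ j \<bullet> y - b x $ j \<ge> 0)}"

definition KKT_set ::
    "'i set \<Rightarrow> ('i \<Rightarrow> (real^'n) \<times> (real^'p) \<Rightarrow> real) \<Rightarrow> ((real^'n) \<times> (real^'p) \<Rightarrow> real)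
      \<Rightarrow> real^'p^'m \<Rightarrow> (real^'n \<Rightarrow> real^'m) \<Rightarrow> ((real^'n) \<times> (real^'p)) set" where
  "KKT_set I h f A b =
     {(x, y) \<in> constraint_set I h A b. \<exists>l :: real^'m.
        grad_y f x y - transpose A *v l = 0 \<and>
        (\<forall>j. A $ j \<bullet> y - b x $ j \<ge> 0 \<and> l $ j \<ge> 0 \<and> l $ j * (A $ j \<bullet> y - b x $ j) = 0)}"

text \<open>
  The row submatrix of A indexed by J is kept in the type of A by replacing the rows outside J
  with zero rows. This changes neither its rank nor its transpose applied to a multiplier vector:
  the entries of the vector outside J play no role (see the two lemmas below).
\<close>

definition row_submatrix :: "real^'p^'m \<Rightarrow> 'm set \<Rightarrow> real^'p^'m" where
  "row_submatrix A J = (\<chi> j. if j \<in> J then A $ j else 0)"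

lemma rank_row_submatrix: "rank (row_submatrix A J) = dim ((\<lambda>j. A $ j) ` J)"
proof -
  have "rows (row_submatrix A J) - {0} = (\<lambda>j. A $ j) ` J - {0}"
    by (auto simp: rows_def row_def row_submatrix_def)
  hence "span (rows (row_submatrix A J)) = span ((\<lambda>j. A $ j) ` J)"
    by (metis span_delete_0)
  thus ?thesis by (metis dim_span row_rank_def)
qed

lemma transpose_row_submatrix_mult:
  "transpose (row_submatrix A J) *v l = (\<Sum>j\<in>J. l $ j *\<^sub>R A $ j)"
proof -
  have "(transpose (row_submatrix A J) *v l) $ k = (\<Sum>j\<in>J. l $ j *\<^sub>R A $ j) $ k" for k
  proof -
    have "(transpose (row_submatrix A J) *v l) $ k
        = (\<Sum>j\<in>UNIV. if j \<in> J then l $ j * A $ j $ k else 0)"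
      unfolding matrix_vector_mult_def transpose_def row_submatrix_def by (auto intro: sum.cong)
    thus ?thesis by (simp add: sum.If_cases)
  qed
  thus ?thesis by (simp add: vec_eq_iff)
qed

text \<open>Full rank of the |J| by p submatrix means that its rank is the minimum of |J| and p.\<close>

definition full_rank_index_sets :: "real^'p^'m \<Rightarrow> 'm set set" where
  "full_rank_index_sets A =
     {J. card J = rank A \<and> rank (row_submatrix A J) = min (card J) CARD('p)}"

definition KKT_set_J ::
    "'i set \<Rightarrow> ('i \<Rightarrow> (real^'n) \<times> (real^'p) \<Rightarrow> real) \<Rightarrow> ((real^'n) \<times> (real^'p) \<Rightarrow> real)
      \<Rightarrow> real^'p^'m \<Rightarrow> (real^'n \<Rightarrow> real^'m) \<Rightarrow> 'm set \<Rightarrow> ((real^'n) \<times> (real^'p)) set" where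
  "KKT_set_J I h f A b J =
     {(x, y) \<in> constraint_set I h A b. \<exists>l :: real^'m.
        grad_y f x y - transpose (row_submatrix A J) *v l = 0 \<and>
        (\<forall>j\<in>J. A $ j \<bullet> y - b x $ j \<ge> 0 \<and> l $ j \<ge> 0 \<and> l $ j * (A $ j \<bullet> y - b x $ j) = 0)}"

end

theory Submission
  imports Defs
begin

text \<open>
  In \<open>KKT_set\<close> the gradient of \<open>f\<close> is a nonnegative combination of the rows of \<open>A\<close> that
  are active at \<open>y\<close>. The theorem is the conic form of Caratheodory's theorem
  (\<open>conic_caratheodory\<close>): every such combination can be rewritten with nonnegative
  coefficients on a linearly independent subfamily of the rows that already occur in it. The
  support only shrinks, so complementarity survives. The independent subfamily is then completed
  to a row basis, that is, to some \<open>J\<close> in \<open>full_rank_index_sets A\<close>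
  (\<open>independent_subfamily_extends_to_basis\<close>), with zero multipliers on the new rows. Those rows
  need not be active, which is harmless because their multipliers vanish. Conversely, multipliers
  for \<open>J\<close> become multipliers for all rows when they are extended by zero.

  Different indices may carry equal rows, so independence is always a property of the indexed
  family: the rows are independent as a set and the indexing is injective.
\<close>

text \<open>
  The failure of independence of an indexed family, in either of its two forms (a repeated vector
  or a dependent set of vectors), is a nontrivial linear relation. Changing its sign if necessary
  makes one coefficient positive, which is the direction in which Caratheodory's theorem moves.
\<close>

lemma dependent_family_relation:
  fixes a :: "'i \<Rightarrow> 'v::real_vector"
  assumes fin: "finite S" and dep: "\<not> (inj_on a S \<and> independent (a ` S))"
  obtains c k where "(\<Sum>j\<in>S. c j *\<^sub>R a j) = 0" "k \<in> S" "c k > 0"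
proof -
  have "\<exists>c k. (\<Sum>j\<in>S. c j *\<^sub>R a j) = 0 \<and> k \<in> S \<and> c k \<noteq> (0::real)"
  proof (cases "inj_on a S")
    case False
    then obtain i j where ij: "i \<in> S" "j \<in> S" "i \<noteq> j" "a i = a j"
      by (auto simp: inj_on_def)
    define c :: "'i \<Rightarrow> real" where "c = (\<lambda>k. if k = i then 1 else if k = j then -1 else 0)"
    have "(\<Sum>k\<in>S. c k *\<^sub>R a k) = (\<Sum>k\<in>{i, j}. c k *\<^sub>R a k)"
      using fin ij by (intro sum.mono_neutral_right) (auto simp: c_def)
    also have "\<dots> = 0" using ij by (simp add: c_def)
    finally have "(\<Sum>k\<in>S. c k *\<^sub>R a k) = 0" .
    moreover have "c i \<noteq> 0" by (simp add: c_def)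
    ultimately show ?thesis using ij(1) by blast
  next
    case True
    with dep have "dependent (a ` S)" by blast
    then obtain u where u: "\<exists>v\<in>a ` S. u v \<noteq> 0" "(\<Sum>v\<in>a ` S. u v *\<^sub>R v) = 0"
      using fin by (auto simp: dependent_finite)
    have "(\<Sum>j\<in>S. u (a j) *\<^sub>R a j) = 0"
      using u(2) by (simp add: sum.reindex[OF True])
    moreover obtain k where "k \<in> S" "u (a k) \<noteq> 0" using u(1) by blast
    ultimately show ?thesis by (intro exI[of _ "\<lambda>j. u (a j)"] exI[of _ k]) simp
  qed
  then obtain c k where c: "(\<Sum>j\<in>S. c j *\<^sub>R a j) = 0" "k \<in> S" "c k \<noteq> (0::real)"
    by blast
  show thesis
  proof (cases "c k > 0")
    case True
    with c that show thesis by blast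
  next
    case False
    have "(\<Sum>j\<in>S. (- c j) *\<^sub>R a j) = 0" using c(1) by (simp add: sum_negf)
    with False c that[of "\<lambda>j. - c j" k] show thesis by simp
  qed
qed

text \<open>
  As long as the family is dependent, the coefficients can be moved along a linear relation until
  the first of them reaches zero. The combination is unchanged, nonnegativity is kept, and one
  index drops out.
\<close>

lemma conic_caratheodory:
  fixes a :: "'i \<Rightarrow> 'v::real_vector"
  assumes "finite S" and "\<And>j. j \<in> S \<Longrightarrow> 0 \<le> l j"
  shows "\<exists>T m. T \<subseteq> S \<and> inj_on a T \<and> independent (a ` T) \<and> (\<forall>j\<in>T. 0 \<le> m j) \<and>
    (\<Sum>j\<in>T. m j *\<^sub>R a j) = (\<Sum>j\<in>S. l j *\<^sub>R a j)"
  using assms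
proof (induction S arbitrary: l rule: finite_psubset_induct)
  case (psubset S)
  show ?case
  proof (cases "inj_on a S \<and> independent (a ` S)")
    case True
    then show ?thesis using psubset.prems by blast
  next
    case False
    then obtain c k where c: "(\<Sum>j\<in>S. c j *\<^sub>R a j) = 0" "k \<in> S" "c k > 0"
      using dependent_family_relation[OF psubset.hyps] by blast
    define P where "P = {j \<in> S. c j > 0}"
    have "finite P" "P \<noteq> {}" using psubset.hyps c by (auto simp: P_def)
    \<comment> \<open>The index with the smallest ratio is the first whose coefficient reaches zero.\<close>
    then obtain i where i: "i \<in> P" "\<And>j. j \<in> P \<Longrightarrow> l i / c i \<le> l j / c j"
      using ex_is_arg_min_if_finite[of P "\<lambda>j. l j / c j"]
      by (auto simp: is_arg_min_def not_less)
    define \<theta> where "\<theta> = l i / c i"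
    define l' where "l' = (\<lambda>j. l j - \<theta> * c j)"
    have i': "i \<in> S" "c i > 0" using i(1) by (auto simp: P_def)
    have \<theta>: "\<theta> \<ge> 0" using i' psubset.prems by (simp add: \<theta>_def)
    have l'_i: "l' i = 0" using i' by (simp add: l'_def \<theta>_def)
    have l'_nonneg: "0 \<le> l' j" if "j \<in> S" for j
    proof (cases "c j > 0")
      case True
      with i(2)[of j] that show ?thesis by (simp add: P_def \<theta>_def l'_def pos_le_divide_eq)
    next
      case False
      then have "\<theta> * c j \<le> 0" using \<theta> by (simp add: mult_nonneg_nonpos)
      with psubset.prems[OF that] show ?thesis by (simp add: l'_def)
    qed
    have "(\<Sum>j\<in>S - {i}. l' j *\<^sub>R a j) = (\<Sum>j\<in>S. l' j *\<^sub>R a j)"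
      using psubset.hyps i'(1) l'_i by (simp add: sum.remove)
    also have "\<dots> = (\<Sum>j\<in>S. l j *\<^sub>R a j) - \<theta> *\<^sub>R (\<Sum>j\<in>S. c j *\<^sub>R a j)"
      by (simp add: l'_def scaleR_left_diff_distrib sum_subtractf scaleR_sum_right)
    finally have "(\<Sum>j\<in>S - {i}. l' j *\<^sub>R a j) = (\<Sum>j\<in>S. l j *\<^sub>R a j)"
      using c(1) by simp
    moreover have "\<exists>T m. T \<subseteq> S - {i} \<and> inj_on a T \<and> independent (a ` T) \<and>
        (\<forall>j\<in>T. 0 \<le> m j) \<and> (\<Sum>j\<in>T. m j *\<^sub>R a j) = (\<Sum>j\<in>S - {i}. l' j *\<^sub>R a j)"
      using i'(1) l'_nonneg by (intro psubset.IH) auto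
    ultimately show ?thesis by (metis Diff_subset order_trans)
  qed
qed

text \<open>
  Steinitz extension at the level of indices: each basis vector added to the set \<open>a ` T\<close> is
  given one index.
\<close>

lemma independent_subfamily_extends_to_basis:
  fixes a :: "'i \<Rightarrow> 'v::euclidean_space"
  assumes "inj_on a T" and "independent (a ` T)"
  obtains J where "T \<subseteq> J" "inj_on a J" "independent (a ` J)" "card J = dim (range a)"
proof -
  obtain B where B: "a ` T \<subseteq> B" "B \<subseteq> range a" "independent B" "range a \<subseteq> span B"
    using maximal_independent_subset_extend[of "a ` T" "range a"] assms(2) by auto
  obtain C where C: "inj_on a C" "a ` C = B - a ` T"
    using B(2) by (metis Diff_subset order_trans subset_image_inj)
  have img: "a ` (T \<union> C) = B" using B(1) C(2) by auto
  have inj: "inj_on a (T \<union> C)" using assms(1) C by (auto simp: inj_on_Un)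
  have "card (T \<union> C) = dim (range a)"
    using B img card_image[OF inj] by (metis basis_card_eq_dim)
  with that[of "T \<union> C"] inj img B(3) show thesis by simp
qed

lemma rank_eq_dim_rows: "rank A = dim (range (\<lambda>j. A $ j))" for A :: "real^'p^'m"
  using rank_row_submatrix[of A UNIV] by (simp add: row_submatrix_def)

lemma independent_rows_in_full_rank_index_sets:
  fixes A :: "real^'p^'m"
  assumes "inj_on (\<lambda>j. A $ j) J" "independent ((\<lambda>j. A $ j) ` J)"
    and "card J = dim (range (\<lambda>j. A $ j))"
  shows "J \<in> full_rank_index_sets A"
proof -
  have "rank (row_submatrix A J) = card J"
    using assms by (simp add: rank_row_submatrix dim_eq_card_independent card_image)
  moreover have "card J \<le> CARD('p)"
    using assms(3) dim_subset_UNIV[of "range (\<lambda>j. A $ j)"] by simp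
  ultimately show ?thesis
    using assms(3) by (simp add: full_rank_index_sets_def rank_eq_dim_rows)
qed

lemma transpose_mult_eq_sum_rows: "transpose A *v l = (\<Sum>j\<in>UNIV. l $ j *\<^sub>R A $ j)"
  for A :: "real^'p^'m"
  using transpose_row_submatrix_mult[of A UNIV l] by (simp add: row_submatrix_def)

lemma KKT_set_J_subset_KKT_set: "KKT_set_J I h f A b J \<subseteq> KKT_set I h f A b"
proof clarify
  fix x y
  assume "(x, y) \<in> KKT_set_J I h f A b J"
  then obtain l where U: "(x, y) \<in> constraint_set I h A b"
    and grad: "grad_y f x y = (\<Sum>j\<in>J. l $ j *\<^sub>R A $ j)"
    and l: "\<And>j. j \<in> J \<Longrightarrow> 0 \<le> l $ j \<and> l $ j * (A $ j \<bullet> y - b x $ j) = 0"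
    unfolding KKT_set_J_def transpose_row_submatrix_mult by auto
  define m where "m = (\<chi> j. if j \<in> J then l $ j else 0)"
  have "(\<Sum>j\<in>UNIV. m $ j *\<^sub>R A $ j) = (\<Sum>j\<in>J. l $ j *\<^sub>R A $ j)"
    by (intro sum.mono_neutral_cong_right) (auto simp: m_def)
  moreover have "A $ j \<bullet> y - b x $ j \<ge> 0" for j
    using U by (auto simp: constraint_set_def)
  moreover have "0 \<le> m $ j \<and> m $ j * (A $ j \<bullet> y - b x $ j) = 0" for j
    using l[of j] by (simp add: m_def)
  ultimately show "(x, y) \<in> KKT_set I h f A b"
    unfolding KKT_set_def transpose_mult_eq_sum_rows using U grad
    by (auto intro!: exI[of _ m])
qed

lemma KKT_set_subset_Union_KKT_set_J:
  "KKT_set I h f A b \<subseteq> (\<Union>J \<in> full_rank_index_sets A. KKT_set_J I h f A b J)"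
proof clarify
  fix x y
  assume "(x, y) \<in> KKT_set I h f A b"
  then obtain l where U: "(x, y) \<in> constraint_set I h A b"
    and grad: "grad_y f x y = (\<Sum>j\<in>UNIV. l $ j *\<^sub>R A $ j)"
    and l: "\<And>j. 0 \<le> l $ j \<and> l $ j * (A $ j \<bullet> y - b x $ j) = 0"
    unfolding KKT_set_def transpose_mult_eq_sum_rows by auto
  define S where "S = {j. l $ j \<noteq> 0}"
  obtain T m where T: "T \<subseteq> S" "inj_on (\<lambda>j. A $ j) T" "independent ((\<lambda>j. A $ j) ` T)"
    and m: "\<forall>j\<in>T. 0 \<le> m j" "(\<Sum>j\<in>T. m j *\<^sub>R A $ j) = (\<Sum>j\<in>S. l $ j *\<^sub>R A $ j)"
    using conic_caratheodory[of S "\<lambda>j. l $ j" "\<lambda>j. A $ j"] l by auto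
  obtain J where J: "T \<subseteq> J" "inj_on (\<lambda>j. A $ j) J" "independent ((\<lambda>j. A $ j) ` J)"
      "card J = dim (range (\<lambda>j. A $ j))"
    using independent_subfamily_extends_to_basis[OF T(2,3)] by blast
  define n where "n = (\<chi> j. if j \<in> T then m j else 0)"
  have "(\<Sum>j\<in>J. n $ j *\<^sub>R A $ j) = (\<Sum>j\<in>T. m j *\<^sub>R A $ j)"
    using J(1) by (intro sum.mono_neutral_cong_right) (auto simp: n_def)
  also have "\<dots> = (\<Sum>j\<in>UNIV. l $ j *\<^sub>R A $ j)"
    unfolding m(2) by (intro sum.mono_neutral_left) (auto simp: S_def)
  finally have "grad_y f x y = (\<Sum>j\<in>J. n $ j *\<^sub>R A $ j)" using grad by simp
  moreover have "A $ j \<bullet> y - b x $ j \<ge> 0" for j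
    using U by (auto simp: constraint_set_def)
  moreover have "0 \<le> n $ j \<and> n $ j * (A $ j \<bullet> y - b x $ j) = 0" for j
    using T(1) m(1) l[of j] by (auto simp: n_def S_def)
  ultimately have "(x, y) \<in> KKT_set_J I h f A b J"
    unfolding KKT_set_J_def transpose_row_submatrix_mult using U
    by (auto intro!: exI[of _ n])
  with independent_rows_in_full_rank_index_sets[OF J(2-4)]
  show "(x, y) \<in> (\<Union>J \<in> full_rank_index_sets A. KKT_set_J I h f A b J)" by blast
qed

theorem theorem2p4:
  fixes F f :: "(real^'n) \<times> (real^'p) \<Rightarrow> real"
    and I1 :: "'i set"
    and h :: "'i \<Rightarrow> (real^'n) \<times> (real^'p) \<Rightarrow> real"
    and A :: "real^'p^'m"
    and b :: "real^'n \<Rightarrow> real^'m"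
  assumes "real_polynomial_function F"
    and "real_polynomial_function f"
    and "finite I1"
    and "\<And>i. i \<in> I1 \<Longrightarrow> real_polynomial_function (h i)"
    and "\<And>j. real_polynomial_function (\<lambda>x. b x $ j)"
    and "\<And>x y. (x, y) \<in> constraint_set I1 h A b \<Longrightarrow> lower_solutions f A b x \<noteq> {}"
  shows "KKT_set I1 h f A b = (\<Union>J \<in> full_rank_index_sets A. KKT_set_J I1 h f A b J)"
  using KKT_set_subset_Union_KKT_set_J KKT_set_J_subset_KKT_set by fast

end
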